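(* Let $H$ be a complex Hilbert space and let $T\in\mathcal{B}(H)$. Then $$M(T)^2=0\iff T^2=0.$$
   Context: $\mathcal{B}(H)$ is the algebra of bounded linear operators on $H$. For $T\in\mathcal{B}(H)$, $|T|=(T^*T)^{1/2}$, and the polar decomposition $T=V|T|$ is the canonical one: $V$ is the unique partial isometry with $T=V|T|$ and $\ker(V)=\ker(T)$. The mean transform of $T$ is $M(T)=\frac12(T+|T|V)$. *)

theory Defs
  imports "HOL-Analysis.Analysis"
begin

text \<open>
  Complex inner product spaces. The library's real inner product, and with it the norm, is required
  to be the one induced by the complex inner product, namely its real part; positive definiteness
  is thus inherited from \<^class>\<open>real_inner\<close>. The inner product is linear in its first argument.
\<close>

class complex_inner = real_inner +
  fixes scaleC :: "complex \<Rightarrow> 'a \<Rightarrow> 'a" (infixr "*\<^sub>C" 75)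
    and cinner :: "'a \<Rightarrow> 'a \<Rightarrow> complex"
  assumes scaleC_add_right: "a *\<^sub>C (x + y) = a *\<^sub>C x + a *\<^sub>C y"
    and scaleC_add_left: "(a + b) *\<^sub>C x = a *\<^sub>C x + b *\<^sub>C x"
    and scaleC_scaleC: "a *\<^sub>C b *\<^sub>C x = (a * b) *\<^sub>C x"
    and scaleR_eq_scaleC: "r *\<^sub>R x = complex_of_real r *\<^sub>C x"
    and cinner_commute: "cinner x y = cnj (cinner y x)"
    and cinner_add_left: "cinner (x + y) z = cinner x z + cinner y z"
    and cinner_scaleC_left: "cinner (a *\<^sub>C x) y = a * cinner x y"
    and inner_eq_Re_cinner: "inner x y = Re (cinner x y)"

lemma cinner_self:
  fixes x :: "'a::complex_inner"
  shows "cinner x x = complex_of_real ((norm x)\<^sup>2)"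
proof -
  have "Im (cinner x x) = Im (cnj (cinner x x))"
    using cinner_commute[of x x] by (rule arg_cong)
  hence "Im (cinner x x) = 0" by simp
  moreover have "Re (cinner x x) = (norm x)\<^sup>2"
    by (simp add: inner_eq_Re_cinner[symmetric] power2_norm_eq_inner)
  ultimately show ?thesis by (simp add: complex_eq_iff)
qed

class chilbert_space = complex_inner + complete_space

instantiation complex :: chilbert_space
begin

definition scaleC_complex :: "complex \<Rightarrow> complex \<Rightarrow> complex" where
  "scaleC_complex a x = a * x"

definition cinner_complex :: "complex \<Rightarrow> complex \<Rightarrow> complex" where
  "cinner_complex x y = x * cnj y"

instance
  by standard
    (simp_all add: scaleC_complex_def cinner_complex_def algebra_simps scaleR_conv_of_real
      inner_complex_def)

end

text \<open>
  The library type of bounded linear maps only knows about real scalars, so \<open>\<B>(H)\<close> is the set of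
  those that are also complex linear.
\<close>

definition bounded_ops :: "('a::complex_inner \<Rightarrow>\<^sub>L 'a) set" where
  "bounded_ops = {T. \<forall>a x. blinfun_apply T (a *\<^sub>C x) = a *\<^sub>C blinfun_apply T x}"

definition adj_op :: "('a::chilbert_space \<Rightarrow>\<^sub>L 'a) \<Rightarrow> ('a \<Rightarrow>\<^sub>L 'a)" where
  "adj_op T = (THE S. S \<in> bounded_ops \<and>
     (\<forall>x y. cinner (blinfun_apply T x) y = cinner x (blinfun_apply S y)))"

definition positive_op :: "('a::complex_inner \<Rightarrow>\<^sub>L 'a) \<Rightarrow> bool" where
  "positive_op P \<longleftrightarrow> P \<in> bounded_ops \<and> (\<forall>x. cinner (blinfun_apply P x) x \<in> \<real>\<^sub>\<ge>\<^sub>0)"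

definition sqrt_op :: "('a::chilbert_space \<Rightarrow>\<^sub>L 'a) \<Rightarrow> ('a \<Rightarrow>\<^sub>L 'a)" where
  "sqrt_op A = (THE P. positive_op P \<and> P o\<^sub>L P = A)"

definition abs_op :: "('a::chilbert_space \<Rightarrow>\<^sub>L 'a) \<Rightarrow> ('a \<Rightarrow>\<^sub>L 'a)" where
  "abs_op T = sqrt_op (adj_op T o\<^sub>L T)"

definition ker_op :: "('a::complex_inner \<Rightarrow>\<^sub>L 'a) \<Rightarrow> 'a set" where
  "ker_op T = {x. blinfun_apply T x = 0}"

definition corthogonal_comp :: "'a::complex_inner set \<Rightarrow> 'a set" where
  "corthogonal_comp S = {x. \<forall>y\<in>S. cinner x y = 0}"

definition partial_isometry :: "('a::complex_inner \<Rightarrow>\<^sub>L 'a) \<Rightarrow> bool" where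
  "partial_isometry V \<longleftrightarrow> V \<in> bounded_ops \<and>
     (\<forall>x \<in> corthogonal_comp (ker_op V). norm (blinfun_apply V x) = norm x)"

text \<open>The partial isometry \<open>V\<close> of the canonical polar decomposition \<open>T = V|T|\<close>.\<close>

definition polar_op :: "('a::chilbert_space \<Rightarrow>\<^sub>L 'a) \<Rightarrow> ('a \<Rightarrow>\<^sub>L 'a)" where
  "polar_op T = (THE V. partial_isometry V \<and> T = V o\<^sub>L abs_op T \<and> ker_op V = ker_op T)"

definition mean_transform :: "('a::chilbert_space \<Rightarrow>\<^sub>L 'a) \<Rightarrow> ('a \<Rightarrow>\<^sub>L 'a)" where
  "mean_transform T = (1/2) *\<^sub>R (T + (abs_op T o\<^sub>L polar_op T))"

end

theory Submission
  imports Defs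
begin

text \<open>
  Write \<open>P = |T|\<close>, \<open>T = V P\<close> and \<open>N = T + P V\<close>, so that \<open>N\<close> is twice the mean transform. The kernels
  of \<open>T\<close>, \<open>P\<close> and \<open>V\<close> coincide.

  If \<open>T\<^sup>2 = 0\<close>, then \<open>T\<close>, hence also \<open>P\<close>, vanishes on the range of \<open>T\<close>, so \<open>P V P = 0\<close>. Thus \<open>P V\<close>
  vanishes on the range of \<open>P\<close> and on its kernel, which together span a dense subspace; therefore
  \<open>P V = 0\<close> and \<open>N = T\<close>.

  Conversely let \<open>N\<^sup>2 = 0\<close>. For \<open>y\<close> in the range of \<open>N\<close>, pairing \<open>N y = 0\<close> with \<open>V y\<close> gives
  \<open>\<langle>T y, V y\<rangle> + \<langle>P V y, V y\<rangle> = 0\<close>. The first term is \<open>\<langle>P y, y\<rangle>\<close>, because \<open>V\<close> preserves inner products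
  on the closed range of \<open>P\<close> (\<open>inner_polar_op\<close>). Both terms are nonnegative, so \<open>\<langle>P y, y\<rangle> = 0\<close> and
  \<open>P y = 0\<close>. Hence \<open>P N = 0\<close>, which says that \<open>X = P V\<close> anticommutes with \<open>P\<close>. Then \<open>X\<close> commutes
  with \<open>P\<^sup>2 = T\<^sup>* T\<close>, and so with its positive square root \<open>P\<close> (\<open>commutes_with_abs_op\<close>). An operator
  that both commutes and anticommutes with \<open>P\<close> satisfies \<open>P X = 0\<close>; thus \<open>P\<^sup>2 V = 0\<close>, so \<open>P V = 0\<close>,
  and finally \<open>T\<^sup>2 = V P V P = 0\<close>.

  The adjoint, the modulus and the polar factor are definite descriptions, so most of the text
  establishes existence and uniqueness of these operators. Nearly everything is done with the real
  inner product: a real adjoint, square root or polar factor inherits complex linearity because it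
  commutes with all scalar multiplications.
\<close>

section \<open>Orthogonal projection and adjoints\<close>

text \<open>
  A sequence in the subspace whose distance to \<open>x\<close> tends to the infimum is Cauchy by the
  parallelogram law. Its limit is a nearest point to \<open>x\<close>, and minimality in every direction \<open>y\<close> of
  the subspace forces orthogonality.
\<close>
lemma closed_subspace_orthogonal_decomposition:
  fixes S :: "'a::{real_inner, complete_space} set"
  assumes sub: "subspace S" and "closed S"
  obtains s where "s \<in> S" and "\<And>y. y \<in> S \<Longrightarrow> inner (x - s) y = 0"
proof -
  define d where "d = infdist x S"
  have ne: "S \<noteq> {}" using subspace_0[OF sub] by auto
  have d0: "d \<ge> 0" unfolding d_def by (rule infdist_nonneg)
  have dle: "d \<le> norm (x - y)" if "y \<in> S" for y
    using infdist_le[OF that, of x] by (simp add: d_def dist_norm)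
  have "\<exists>s\<in>S. norm (x - s) < d + 1 / real (Suc n)" for n
  proof (rule ccontr)
    assume "\<not> ?thesis"
    hence "d + 1 / real (Suc n) \<le> dist x s" if "s \<in> S" for s
      using that by (auto simp: dist_norm not_less)
    hence "d + 1 / real (Suc n) \<le> infdist x S"
      unfolding infdist_notempty[OF ne] by (intro cINF_greatest ne) auto
    thus False by (simp add: d_def)
  qed
  then obtain s where sS: "\<And>n. s n \<in> S" and s: "\<And>n. norm (x - s n) < d + 1 / real (Suc n)"
    by metis
  have "(\<lambda>n. norm (x - s n)) \<longlonglongrightarrow> d"
  proof (rule tendsto_sandwich[OF _ _ tendsto_const])
    show "\<forall>\<^sub>F n in sequentially. d \<le> norm (x - s n)" using dle[OF sS] by simp
    show "\<forall>\<^sub>F n in sequentially. norm (x - s n) \<le> d + 1 / real (Suc n)"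
      using s by (simp add: less_imp_le)
    show "(\<lambda>n. d + 1 / real (Suc n)) \<longlonglongrightarrow> d"
      using tendsto_add[OF tendsto_const[of d] LIMSEQ_inverse_real_of_nat]
      by (simp add: inverse_eq_divide)
  qed
  hence sq: "(\<lambda>n. (norm (x - s n))\<^sup>2) \<longlonglongrightarrow> d\<^sup>2" by (intro tendsto_intros)
  have "Cauchy s"
  proof (rule CauchyI)
    fix e :: real assume e: "e > 0"
    have "\<forall>\<^sub>F n in sequentially. (norm (x - s n))\<^sup>2 < d\<^sup>2 + e\<^sup>2 / 4"
      using e by (intro order_tendstoD(2)[OF sq]) simp
    then obtain N where N: "\<And>n. n \<ge> N \<Longrightarrow> (norm (x - s n))\<^sup>2 < d\<^sup>2 + e\<^sup>2 / 4"
      by (auto simp: eventually_sequentially)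
    have "norm (s m - s n) < e" if "m \<ge> N" "n \<ge> N" for m n
    proof -
      \<comment> \<open>Parallelogram law, with the midpoint of \<open>s m\<close> and \<open>s n\<close> again in \<open>S\<close>.\<close>
      have "(norm (s m - s n))\<^sup>2 = 2 * (norm (x - s m))\<^sup>2 + 2 * (norm (x - s n))\<^sup>2
          - 4 * (norm (x - (1/2) *\<^sub>R (s m + s n)))\<^sup>2"
        unfolding power2_norm_eq_inner
        by (simp add: inner_simps inner_commute field_simps)
      moreover have "d\<^sup>2 \<le> (norm (x - (1/2) *\<^sub>R (s m + s n)))\<^sup>2"
        using d0 by (intro power_mono dle subspace_scale subspace_add sub sS)
      ultimately have "(norm (s m - s n))\<^sup>2 < e\<^sup>2"
        using N[OF that(1)] N[OF that(2)] by linarith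
      thus ?thesis using e by (simp add: power2_less_imp_less)
    qed
    thus "\<exists>N. \<forall>m\<ge>N. \<forall>n\<ge>N. norm (s m - s n) < e" by blast
  qed
  then obtain l where l: "s \<longlonglongrightarrow> l" using Cauchy_convergent convergent_def by blast
  have lS: "l \<in> S" using closed_sequentially[OF \<open>closed S\<close> _ l] sS by auto
  have "(\<lambda>n. norm (x - s n)) \<longlonglongrightarrow> norm (x - l)" by (intro tendsto_intros l)
  hence ld: "norm (x - l) = d"
    using \<open>(\<lambda>n. norm (x - s n)) \<longlonglongrightarrow> d\<close> LIMSEQ_unique by blast
  have "inner (x - l) y = 0" if "y \<in> S" for y
  proof (cases "y = 0")
    case False
    \<comment> \<open>The step \<open>t\<close> along \<open>y\<close> minimises the distance from \<open>x\<close> to \<open>l + t y\<close>.\<close>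
    define t where "t = inner (x - l) y / (norm y)\<^sup>2"
    have "d\<^sup>2 \<le> (norm (x - (l + t *\<^sub>R y)))\<^sup>2"
      using d0 that by (intro power_mono dle subspace_scale subspace_add sub lS)
    also have "\<dots> = d\<^sup>2 - 2 * t * inner (x - l) y + t\<^sup>2 * (norm y)\<^sup>2"
      unfolding ld[symmetric] power2_norm_eq_inner
      by (simp add: inner_simps inner_commute field_simps power2_eq_square)
    also have "\<dots> = d\<^sup>2 - (inner (x - l) y)\<^sup>2 / (norm y)\<^sup>2"
      using False by (simp add: t_def field_simps power2_eq_square)
    finally have "(inner (x - l) y)\<^sup>2 / (norm y)\<^sup>2 \<le> 0" by simp
    thus ?thesis using False by (simp add: divide_le_0_iff)
  qed simp
  with lS show thesis by (rule that)
qed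

text \<open>
  A nonzero functional is determined by its kernel up to a scalar, so it is pairing with a multiple
  of any nonzero vector orthogonal to that kernel.
\<close>
lemma riesz_representation:
  fixes f :: "'a::{real_inner, complete_space} \<Rightarrow> real"
  assumes "bounded_linear f"
  obtains z where "\<And>x. f x = inner x z"
proof (cases "\<forall>x. f x = 0")
  case True
  thus ?thesis using that[of 0] by simp
next
  case False
  then obtain x0 where x0: "f x0 \<noteq> 0" by blast
  interpret bounded_linear f by fact
  have "subspace {x. f x = 0}" by (auto simp: subspace_def add scaleR zero)
  moreover have "closed {x. f x = 0}"
    by (intro closed_Collect_eq continuous_on_const linear_continuous_on assms)
  ultimately obtain s where s: "s \<in> {x. f x = 0}"
    "\<And>y. y \<in> {x. f x = 0} \<Longrightarrow> inner (x0 - s) y = 0"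
    by (rule closed_subspace_orthogonal_decomposition[where x = x0]) blast
  define u where "u = x0 - s"
  have fu: "f u \<noteq> 0" using s(1) x0 by (simp add: u_def diff)
  hence u: "inner u u \<noteq> 0" by (auto simp: zero)
  have "f x = inner x ((f u / inner u u) *\<^sub>R u)" for x
  proof -
    have "x - (f x / f u) *\<^sub>R u \<in> {x. f x = 0}" using fu by (simp add: diff scaleR)
    hence "inner u (x - (f x / f u) *\<^sub>R u) = 0" unfolding u_def by (rule s(2))
    thus ?thesis using fu u by (simp add: inner_simps inner_commute field_simps)
  qed
  thus ?thesis by (rule that)
qed

lemma real_adjoint_exists:
  fixes T :: "'a::{real_inner, complete_space} \<Rightarrow>\<^sub>L 'a"
  obtains S :: "'a \<Rightarrow>\<^sub>L 'a" where "\<And>x y. inner (T x) y = inner x (S y)"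
proof -
  have "\<exists>z. \<forall>x. inner (T x) y = inner x z" for y
  proof -
    have "bounded_linear (\<lambda>x. inner (T x) y)"
      by (intro bounded_linear_inner_left_comp blinfun.bounded_linear_right)
    thus ?thesis by (rule riesz_representation) blast
  qed
  then obtain S where S: "\<And>x y. inner (T x) y = inner x (S y)" by metis
  have "bounded_linear S"
  proof (rule bounded_linear_intro[where K = "norm T"])
    show "S (x + y) = S x + S y" for x y
    proof (rule vector_eq_ldot[THEN iffD1], rule allI)
      show "inner z (S (x + y)) = inner z (S x + S y)" for z
        unfolding inner_add_right S[symmetric] ..
    qed
    show "S (r *\<^sub>R x) = r *\<^sub>R S x" for r x
    proof (rule vector_eq_ldot[THEN iffD1], rule allI)
      show "inner z (S (r *\<^sub>R x)) = inner z (r *\<^sub>R S x)" for z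
        unfolding inner_scaleR_right S[symmetric] ..
    qed
    show "norm (S y) \<le> norm y * norm T" for y
    proof (cases "S y = 0")
      case False
      have "norm (S y) * norm (S y) = inner (T (S y)) y"
        by (simp add: S power2_norm_eq_inner[symmetric] power2_eq_square[symmetric])
      also have "\<dots> \<le> norm (T (S y)) * norm y" by (rule norm_cauchy_schwarz)
      also have "\<dots> \<le> norm T * norm (S y) * norm y"
        by (intro mult_right_mono norm_blinfun) simp
      finally have "norm (S y) * norm (S y) \<le> norm (S y) * (norm y * norm T)"
        by (simp add: mult_ac)
      thus ?thesis using False by simp
    qed simp
  qed
  thus ?thesis using that[of "Blinfun S"] S by (simp add: bounded_linear_Blinfun_apply)
qed


section \<open>Complex structure and adjoints of complex linear operators\<close>

lemma cinner_scaleC_right: "cinner x (a *\<^sub>C y) = cnj a * cinner x y"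
  for x y :: "'a::complex_inner"
proof -
  have "cinner x (a *\<^sub>C y) = cnj (cinner (a *\<^sub>C y) x)" by (rule cinner_commute)
  also have "\<dots> = cnj a * cinner x y" by (simp add: cinner_scaleC_left cinner_commute[of x y])
  finally show ?thesis .
qed

lemma inner_scaleC_left: "inner (a *\<^sub>C x) y = inner x (cnj a *\<^sub>C y)"
  for x y :: "'a::complex_inner"
  by (simp add: inner_eq_Re_cinner cinner_scaleC_left cinner_scaleC_right)

text \<open>The imaginary part of the inner product is a real inner product with \<open>\<i> y\<close>; this is what lets
  identities for the real inner product be transferred to the complex one.\<close>
lemma cinner_eq_Complex: "cinner x y = Complex (inner x y) (inner x (\<i> *\<^sub>C y))"
  for x y :: "'a::complex_inner"
  by (simp add: complex_eq_iff inner_eq_Re_cinner cinner_scaleC_right)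

lemma norm_scaleC: "norm (a *\<^sub>C x) = cmod a * norm x"
  for x :: "'a::complex_inner"
proof -
  have "(norm (a *\<^sub>C x))\<^sup>2 = inner x ((cnj a * a) *\<^sub>C x)"
    by (simp add: power2_norm_eq_inner inner_scaleC_left scaleC_scaleC)
  also have "cnj a * a = complex_of_real ((cmod a)\<^sup>2)"
    by (metis complex_norm_square mult.commute of_real_power)
  also have "inner x (complex_of_real ((cmod a)\<^sup>2) *\<^sub>C x) = (cmod a * norm x)\<^sup>2"
    by (simp add: scaleR_eq_scaleC[symmetric] power_mult_distrib power2_norm_eq_inner
        del: of_real_power)
  finally show ?thesis by (simp add: power2_eq_imp_eq)
qed

lemma bounded_linear_scaleC: "bounded_linear (\<lambda>x::'a::complex_inner. a *\<^sub>C x)"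
proof (rule bounded_linear_intro[where K = "cmod a"])
  show "a *\<^sub>C (r *\<^sub>R x) = r *\<^sub>R (a *\<^sub>C x)" for r and x :: 'a
    by (simp add: scaleR_eq_scaleC scaleC_scaleC mult.commute)
qed (simp_all add: scaleC_add_right norm_scaleC mult.commute)

lemma bounded_opsD: "T \<in> bounded_ops \<Longrightarrow> T (a *\<^sub>C x) = a *\<^sub>C T x"
  by (simp add: bounded_ops_def)

lemma real_adjoint_is_complex_adjoint:
  fixes T S :: "'a::complex_inner \<Rightarrow>\<^sub>L 'a"
  assumes T: "T \<in> bounded_ops" and TS: "\<And>x y. inner (T x) y = inner x (S y)"
  shows "S \<in> bounded_ops" and "cinner (T x) y = cinner x (S y)"
proof -
  have S: "S (a *\<^sub>C y) = a *\<^sub>C S y" for a y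
  proof (rule vector_eq_ldot[THEN iffD1], rule allI)
    show "inner x (S (a *\<^sub>C y)) = inner x (a *\<^sub>C S y)" for x
      using inner_scaleC_left[of "cnj a" "T x" y] inner_scaleC_left[of "cnj a" x "S y"]
      by (simp add: TS[symmetric] bounded_opsD[OF T])
  qed
  thus "S \<in> bounded_ops" by (simp add: bounded_ops_def)
  show "cinner (T x) y = cinner x (S y)"
    by (simp add: cinner_eq_Complex TS S)
qed

lemma adj_op_properties:
  fixes T :: "'a::chilbert_space \<Rightarrow>\<^sub>L 'a"
  assumes T: "T \<in> bounded_ops"
  shows adj_op_bounded_ops: "adj_op T \<in> bounded_ops"
    and inner_adj_op: "inner (T x) y = inner x (adj_op T y)"
proof -
  obtain S :: "'a \<Rightarrow>\<^sub>L 'a" where S: "\<And>x y. inner (T x) y = inner x (S y)"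
    using real_adjoint_exists by blast
  have "S \<in> bounded_ops \<and> (\<forall>x y. cinner (T x) y = cinner x (S y))"
    using real_adjoint_is_complex_adjoint[OF T S] by blast
  moreover have "S' = S"
    if "S' \<in> bounded_ops \<and> (\<forall>x y. cinner (T x) y = cinner x (S' y))" for S'
  proof (rule blinfun_eqI)
    fix y
    have "inner x (S' y) = inner x (S y)" for x
      using that S[of x y] by (simp add: inner_eq_Re_cinner)
    thus "S' y = S y" using vector_eq_ldot by blast
  qed
  ultimately have "adj_op T = S" unfolding adj_op_def by (rule the_equality)
  thus "adj_op T \<in> bounded_ops" "inner (T x) y = inner x (adj_op T y)"
    using real_adjoint_is_complex_adjoint(1)[OF T S] S by simp_all
qed

text \<open>
  Over the complex numbers a real quadratic form comes from a self-adjoint operator. In real terms,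
  \<open>\<langle>P x, x\<rangle>\<close> is real exactly when the real inner product of \<open>P x\<close> and \<open>\<i> x\<close> vanishes; polarising this
  at \<open>\<i> y + x\<close> yields symmetry for the real inner product.
\<close>
lemma positive_op_iff:
  fixes P :: "'a::complex_inner \<Rightarrow>\<^sub>L 'a"
  shows "positive_op P \<longleftrightarrow> P \<in> bounded_ops \<and> (\<forall>x y. inner (P x) y = inner x (P y)) \<and>
    (\<forall>x. inner (P x) x \<ge> 0)"
proof (cases "P \<in> bounded_ops")
  case P: True
  have nonneg_iff: "cinner (P x) x \<in> \<real>\<^sub>\<ge>\<^sub>0 \<longleftrightarrow>
      inner (P x) x \<ge> 0 \<and> inner (P x) (\<i> *\<^sub>C x) = 0" for x
    by (simp add: cinner_eq_Complex complex_nonneg_Reals_iff)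
  have "inner (P x) y = inner x (P y)" if *: "\<And>x. inner (P x) (\<i> *\<^sub>C x) = 0" for x y
  proof -
    have "inner (P (\<i> *\<^sub>C y + x)) (\<i> *\<^sub>C (\<i> *\<^sub>C y + x)) = 0" by (rule *)
    hence "inner (\<i> *\<^sub>C P y) (\<i> *\<^sub>C x) + inner (P x) (\<i> *\<^sub>C \<i> *\<^sub>C y) = 0"
      using *[of x] *[of "\<i> *\<^sub>C y"]
      by (simp add: bounded_opsD[OF P] scaleC_add_right blinfun.bilinear_simps inner_simps)
    moreover have "inner (\<i> *\<^sub>C P y) (\<i> *\<^sub>C x) = inner (P y) x"
      using scaleR_eq_scaleC[of 1 x] by (simp add: inner_scaleC_left scaleC_scaleC)
    moreover have "\<i> *\<^sub>C \<i> *\<^sub>C y = - y"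
      using scaleR_eq_scaleC[of "-1" y] by (simp add: scaleC_scaleC)
    ultimately show ?thesis by (simp add: inner_commute)
  qed
  moreover have "inner (P x) (\<i> *\<^sub>C x) = 0" if "\<And>x y. inner (P x) y = inner x (P y)" for x
  proof -
    have "inner (P x) (\<i> *\<^sub>C x) = inner x (\<i> *\<^sub>C P x)" using that by (simp add: bounded_opsD[OF P])
    also have "\<dots> = - inner (\<i> *\<^sub>C x) (P x)"
    proof -
      have "- \<i> *\<^sub>C P x = - (\<i> *\<^sub>C P x)"
        using scaleR_eq_scaleC[of "-1" "\<i> *\<^sub>C P x"] by (simp add: scaleC_scaleC)
      thus ?thesis by (simp add: inner_scaleC_left)
    qed
    finally show ?thesis by (simp add: inner_commute)
  qed
  ultimately show ?thesis using P unfolding positive_op_def nonneg_iff by blast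
qed (simp add: positive_op_def)

section \<open>Positive square roots\<close>

text \<open>
  The form is nonnegative at \<open>y - t P y\<close> for all real \<open>t\<close>, yet its linear coefficient in \<open>t\<close> is
  \<open>- 2 \<parallel>P y\<parallel>\<^sup>2\<close> and its constant term is zero.
\<close>
lemma positive_form_zero_imp_zero:
  fixes P :: "'a::real_inner \<Rightarrow>\<^sub>L 'a"
  assumes sa: "\<And>x y. inner (P x) y = inner x (P y)" and pos: "\<And>x. inner (P x) x \<ge> 0"
    and zero: "inner (P y) y = 0"
  shows "P y = 0"
proof -
  define c where "c = inner (P (P y)) (P y)"
  define b where "b = inner (P y) (P y)"
  have c: "c \<ge> 0" unfolding c_def by (rule pos)
  \<comment> \<open>A small enough step; the summand 1 covers the case \<open>c = 0\<close>.\<close>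
  define t where "t = b / (c + 1)"
  have "0 \<le> inner (P (y - t *\<^sub>R P y)) (y - t *\<^sub>R P y)" by (rule pos)
  also have "\<dots> = inner (P y) y - 2 * t * b + t\<^sup>2 * c"
    by (simp add: blinfun.bilinear_simps inner_simps sa[of "P y" y] b_def c_def
        power2_eq_square algebra_simps)
  also have "\<dots> = - (b\<^sup>2 * (c + 2)) / (c + 1)\<^sup>2"
    using c by (simp add: zero t_def divide_simps) (simp add: power2_eq_square algebra_simps)
  finally have "b\<^sup>2 * (c + 2) \<le> 0" using c by (auto simp: divide_le_0_iff)
  hence "b = 0" using c by (simp add: mult_le_0_iff)
  thus ?thesis by (simp add: b_def)
qed

lemma positive_op_form_zero:
  "positive_op P \<Longrightarrow> inner (P y) y = 0 \<Longrightarrow> P y = 0"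
  using positive_form_zero_imp_zero[of P y] unfolding positive_op_iff by blast

text \<open>
  Commuting square roots satisfy \<open>(P + Q)(P - Q) = 0\<close>. On the range of \<open>P - Q\<close> the positive forms of
  \<open>P\<close> and \<open>Q\<close> therefore add up to zero, so both operators vanish there and \<open>(P - Q)\<^sup>2 = 0\<close>.
\<close>
lemma positive_sqrt_unique:
  fixes P Q :: "'a::complex_inner \<Rightarrow>\<^sub>L 'a"
  assumes P: "positive_op P" and Q: "positive_op Q"
    and eq: "\<And>x. P (P x) = Q (Q x)" and comm: "\<And>x. P (Q x) = Q (P x)"
  shows "P = Q"
proof (rule blinfun_eqI)
  fix x
  define y where "y = P x - Q x"
  have "P y + Q y = 0" by (simp add: y_def blinfun.bilinear_simps eq comm)
  hence "inner (P y) y + inner (Q y) y = 0" by (simp add: inner_add_left[symmetric])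
  moreover have "inner (P y) y \<ge> 0" "inner (Q y) y \<ge> 0"
    using P Q unfolding positive_op_iff by blast+
  ultimately have "inner (P y) y = 0" "inner (Q y) y = 0" by linarith+
  hence "P y = 0" "Q y = 0"
    using P Q positive_op_form_zero by blast+
  hence "inner x (P y - Q y) = 0" by simp
  moreover have "inner x (P y - Q y) = inner y y"
    using P Q by (simp add: positive_op_iff y_def inner_diff_left inner_diff_right
        blinfun.bilinear_simps)
  ultimately show "P x = Q x" by (simp add: y_def)
qed

text \<open>
  A fixed point \<open>Y\<close> of \<open>Y \<mapsto> (B + Y\<^sup>2) / 2\<close> satisfies \<open>(1 - Y)\<^sup>2 = 1 - B\<close>, so \<open>1 - Y\<close> is a square root of
  \<open>1 - B\<close>. The scalar iteration with \<open>B = 1\<close> dominates the operator iteration whenever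
  \<open>\<parallel>B\<parallel> \<le> 1\<close>, and it is increasing and bounded by 1. This gives convergence in operator norm.
\<close>
primrec sqrt_iter :: "('a::real_normed_vector \<Rightarrow>\<^sub>L 'a) \<Rightarrow> nat \<Rightarrow> 'a \<Rightarrow>\<^sub>L 'a" where
  "sqrt_iter B 0 = 0"
| "sqrt_iter B (Suc n) = (1/2) *\<^sub>R (B + (sqrt_iter B n o\<^sub>L sqrt_iter B n))"

primrec sqrt_iter_bound :: "nat \<Rightarrow> real" where
  "sqrt_iter_bound 0 = 0"
| "sqrt_iter_bound (Suc n) = (1 + (sqrt_iter_bound n)\<^sup>2) / 2"

lemma sqrt_iter_bound_range: "0 \<le> sqrt_iter_bound n \<and> sqrt_iter_bound n \<le> 1"
  by (induction n) (auto simp: power_le_one)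

lemma norm_sqrt_iter_le:
  assumes "norm B \<le> 1"
  shows "norm (sqrt_iter B n) \<le> sqrt_iter_bound n"
proof (induction n)
  case (Suc n)
  let ?Y = "sqrt_iter B n"
  have "norm (?Y o\<^sub>L ?Y) \<le> norm ?Y * norm ?Y" by (rule norm_blinfun_compose)
  also have "\<dots> \<le> sqrt_iter_bound n * sqrt_iter_bound n"
    using Suc sqrt_iter_bound_range by (intro mult_mono) auto
  finally have "norm (B + (?Y o\<^sub>L ?Y)) \<le> 1 + sqrt_iter_bound n * sqrt_iter_bound n"
    using assms norm_triangle_ineq[of B "?Y o\<^sub>L ?Y"] by linarith
  thus ?case by (simp add: power2_eq_square)
qed simp

text \<open>
  The induction step rests on \<open>Z\<^sup>2 - Y\<^sup>2 = Z (Z - Y) + (Z - Y) Y\<close>, valid for operators that need not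
  commute; for the bounding scalars the right-hand side is again \<open>z\<^sup>2 - y\<^sup>2\<close>.
\<close>
lemma norm_sqrt_iter_diff_le:
  assumes B: "norm B \<le> 1"
  shows "norm (sqrt_iter B (Suc n) - sqrt_iter B n) \<le> sqrt_iter_bound (Suc n) - sqrt_iter_bound n"
proof (induction n)
  case 0
  thus ?case using B by simp
next
  case (Suc n)
  let ?Y = "sqrt_iter B n" and ?Z = "sqrt_iter B (Suc n)"
  let ?y = "sqrt_iter_bound n" and ?z = "sqrt_iter_bound (Suc n)"
  have "sqrt_iter B (Suc (Suc n)) - ?Z =
      (1/2) *\<^sub>R ((?Z o\<^sub>L (?Z - ?Y)) + ((?Z - ?Y) o\<^sub>L ?Y))"
    \<comment> \<open>Only the outer recursion and the subtracted \<open>?Z\<close> are unfolded; the other copies stay folded.\<close>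
    by (subst sqrt_iter.simps(2)[of B "Suc n"], subst (3) sqrt_iter.simps(2), rule blinfun_eqI)
       (simp add: blinfun.bilinear_simps algebra_simps del: sqrt_iter.simps)
  also have "norm \<dots> \<le> (1/2) * (?z * (?z - ?y) + (?z - ?y) * ?y)"
  proof -
    have "norm (?Z o\<^sub>L (?Z - ?Y)) \<le> norm ?Z * norm (?Z - ?Y)" by (rule norm_blinfun_compose)
    also have "\<dots> \<le> ?z * (?z - ?y)"
      using sqrt_iter_bound_range by (intro mult_mono norm_sqrt_iter_le B Suc) auto
    finally have 1: "norm (?Z o\<^sub>L (?Z - ?Y)) \<le> ?z * (?z - ?y)" .
    have "norm ((?Z - ?Y) o\<^sub>L ?Y) \<le> norm (?Z - ?Y) * norm ?Y" by (rule norm_blinfun_compose)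
    also have "\<dots> \<le> (?z - ?y) * ?y"
      using sqrt_iter_bound_range order_trans[OF norm_ge_zero Suc]
      by (intro mult_mono norm_sqrt_iter_le B Suc) auto
    finally have 2: "norm ((?Z - ?Y) o\<^sub>L ?Y) \<le> (?z - ?y) * ?y" .
    show ?thesis
      using norm_triangle_ineq[of "?Z o\<^sub>L (?Z - ?Y)" "(?Z - ?Y) o\<^sub>L ?Y"] 1 2
      by (simp del: sqrt_iter.simps sqrt_iter_bound.simps)
  qed
  also have "\<dots> = sqrt_iter_bound (Suc (Suc n)) - ?z"
    by (subst sqrt_iter_bound.simps(2)[of "Suc n"], subst (5) sqrt_iter_bound.simps(2))
       (simp add: power2_eq_square field_simps del: sqrt_iter_bound.simps)
  finally show ?case .
qed

lemma sqrt_iter_converges: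
  fixes B :: "'a::banach \<Rightarrow>\<^sub>L 'a"
  assumes B: "norm B \<le> 1"
  obtains Y where "sqrt_iter B \<longlonglongrightarrow> Y" and "norm Y \<le> 1"
    and "\<And>x. Y x = (1/2) *\<^sub>R (B x + Y (Y x))"
proof -
  let ?d = "\<lambda>n. sqrt_iter_bound (Suc n) - sqrt_iter_bound n"
  have mono: "incseq sqrt_iter_bound"
  proof (rule incseq_SucI)
    show "sqrt_iter_bound n \<le> sqrt_iter_bound (Suc n)" for n
      using zero_le_power2[of "1 - sqrt_iter_bound n"] by (simp add: power2_eq_square algebra_simps)
  qed
  obtain l where "sqrt_iter_bound \<longlonglongrightarrow> l"
    using incseq_convergent[OF mono, of 1] sqrt_iter_bound_range by blast
  hence "summable ?d" by (rule sums_summable[OF telescope_sums])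
  hence "summable (\<lambda>n. sqrt_iter B (Suc n) - sqrt_iter B n)"
    by (rule summable_comparison_test') (rule norm_sqrt_iter_diff_le[OF B])
  hence "(\<lambda>n. \<Sum>k<n. sqrt_iter B (Suc k) - sqrt_iter B k) \<longlonglongrightarrow>
      (\<Sum>k. sqrt_iter B (Suc k) - sqrt_iter B k)"
    by (rule summable_LIMSEQ)
  hence "\<exists>Y. sqrt_iter B \<longlonglongrightarrow> Y"
    by (subst (asm) sum_lessThan_telescope) auto
  then obtain Y where Y: "sqrt_iter B \<longlonglongrightarrow> Y" by blast
  have "norm Y \<le> 1"
  proof (rule LIMSEQ_le_const2[OF tendsto_norm[OF Y]])
    show "\<exists>N. \<forall>n\<ge>N. norm (sqrt_iter B n) \<le> 1"
      using norm_sqrt_iter_le[OF B] sqrt_iter_bound_range order_trans by blast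
  qed
  moreover have "Y x = (1/2) *\<^sub>R (B x + Y (Y x))" for x
  proof (rule LIMSEQ_unique)
    show "(\<lambda>n. sqrt_iter B (Suc n) x) \<longlonglongrightarrow> Y x"
      using LIMSEQ_Suc[OF Y] by (intro tendsto_intros)
    show "(\<lambda>n. sqrt_iter B (Suc n) x) \<longlonglongrightarrow> (1/2) *\<^sub>R (B x + Y (Y x))"
      by (simp add: blinfun.bilinear_simps) (intro tendsto_intros Y)
  qed
  ultimately show thesis using Y that by blast
qed

lemma commutes_with_sqrt_limit:
  fixes B S :: "'a::real_normed_vector \<Rightarrow>\<^sub>L 'a"
  assumes Y: "sqrt_iter B \<longlonglongrightarrow> Y" and S: "\<And>x. S (B x) = B (S x)"
  shows "S (Y x) = Y (S x)"
proof (rule LIMSEQ_unique)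
  have "S (sqrt_iter B n x) = sqrt_iter B n (S x)" for n x
    by (induction n arbitrary: x) (simp_all add: blinfun.bilinear_simps S)
  thus "(\<lambda>n. S (sqrt_iter B n x)) \<longlonglongrightarrow> Y (S x)" using Y by (simp add: tendsto_intros)
  show "(\<lambda>n. S (sqrt_iter B n x)) \<longlonglongrightarrow> S (Y x)" by (intro tendsto_intros Y)
qed

lemma selfadjoint_sqrt_limit:
  fixes B :: "'a::real_inner \<Rightarrow>\<^sub>L 'a"
  assumes Y: "sqrt_iter B \<longlonglongrightarrow> Y" and B: "\<And>x y. inner (B x) y = inner x (B y)"
  shows "inner (Y x) y = inner x (Y y)"
proof (rule LIMSEQ_unique)
  have "inner (sqrt_iter B n x) y = inner x (sqrt_iter B n y)" for n x y
    by (induction n arbitrary: x y) (simp_all add: blinfun.bilinear_simps inner_simps B)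
  thus "(\<lambda>n. inner (sqrt_iter B n x) y) \<longlonglongrightarrow> inner x (Y y)" using Y by (simp add: tendsto_intros)
  show "(\<lambda>n. inner (sqrt_iter B n x) y) \<longlonglongrightarrow> inner (Y x) y" by (intro tendsto_intros Y)
qed

instance chilbert_space \<subseteq> banach ..

text \<open>
  After scaling by a bound \<open>c\<close> for the norm of the adjoint, \<open>A = T\<^sup>* T / c\<^sup>2\<close> satisfies
  \<open>\<parallel>A x\<parallel>\<^sup>2 \<le> \<langle>A x, x\<rangle>\<close>, which makes \<open>B = 1 - A\<close> a contraction; the iteration then applies to \<open>B\<close>. Each
  iterate is a polynomial in \<open>B\<close>, so the root commutes with all that commutes with \<open>T\<^sup>* T\<close>. This
  commutation property serves three purposes: complex linearity of the root, its uniqueness, and the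
  main argument.
\<close>
lemma positive_sqrt_exists:
  fixes T :: "'a::chilbert_space \<Rightarrow>\<^sub>L 'a"
  assumes T: "T \<in> bounded_ops"
  obtains P where "positive_op P" and "\<And>x. P (P x) = adj_op T (T x)"
    and "\<And>(S :: 'a \<Rightarrow>\<^sub>L 'a) x. (\<And>x. S (adj_op T (T x)) = adj_op T (T (S x))) \<Longrightarrow> S (P x) = P (S x)"
proof -
  \<comment> \<open>The summand 1 keeps the scale nonzero when \<open>T = 0\<close>.\<close>
  define c where "c = norm (adj_op T) + 1"
  have c: "c > 0" unfolding c_def by (simp add: add_nonneg_pos)
  define A where "A = (1 / c\<^sup>2) *\<^sub>R (adj_op T o\<^sub>L T)"
  define B where "B = id_blinfun - A"
  have A_apply: "A x = (1 / c\<^sup>2) *\<^sub>R adj_op T (T x)" for x by (simp add: A_def blinfun.bilinear_simps)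
  have B_apply: "B x = x - A x" for x by (simp add: B_def blinfun.bilinear_simps)
  have adj: "inner (adj_op T y) x = inner y (T x)" for x y
    using inner_adj_op[OF T, of x y] by (simp add: inner_commute)
  have A_sa: "inner (A x) y = inner x (A y)" for x y
    by (simp add: A_apply adj inner_adj_op[OF T, symmetric])
  have A_contr: "(norm (A x))\<^sup>2 \<le> inner (A x) x" for x
  proof -
    have "norm (adj_op T (T x)) \<le> c * norm (T x)"
      using norm_blinfun[of "adj_op T" "T x"] by (simp add: c_def distrib_right add_increasing2)
    hence "(norm (adj_op T (T x)))\<^sup>2 \<le> c\<^sup>2 * (norm (T x))\<^sup>2"
      by (metis norm_ge_zero power_mono power_mult_distrib)
    hence "(norm (A x))\<^sup>2 \<le> (c\<^sup>2 * (norm (T x))\<^sup>2) / (c\<^sup>2)\<^sup>2"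
      by (simp add: A_apply power_divide divide_right_mono)
    also have "\<dots> = inner (A x) x"
    proof -
      have "(c\<^sup>2 * u) / (c\<^sup>2)\<^sup>2 = u / c\<^sup>2" for u using c by (simp add: power2_eq_square)
      thus ?thesis by (simp add: A_apply adj power2_norm_eq_inner[symmetric])
    qed
    finally show ?thesis .
  qed
  have "norm B \<le> 1"
  proof (rule norm_blinfun_bound)
    fix x
    have "(norm (B x))\<^sup>2 = (norm x)\<^sup>2 - 2 * inner (A x) x + (norm (A x))\<^sup>2"
      by (simp add: B_apply power2_norm_eq_inner inner_simps inner_commute)
    also have "\<dots> \<le> (norm x)\<^sup>2"
      using A_contr[of x] order_trans[OF zero_le_power2 A_contr[of x]] by linarith
    finally have "norm (B x) \<le> norm x" by (rule power2_le_imp_le) simp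
    thus "norm (B x) \<le> 1 * norm x" by simp
  qed simp
  then obtain Y where lim: "sqrt_iter B \<longlonglongrightarrow> Y" and Y1: "norm Y \<le> 1"
    and Y: "\<And>x. Y x = (1/2) *\<^sub>R (B x + Y (Y x))"
    by (rule sqrt_iter_converges) blast
  define P where "P = c *\<^sub>R (id_blinfun - Y)"
  have P_apply: "P x = c *\<^sub>R (x - Y x)" for x by (simp add: P_def blinfun.bilinear_simps)
  have PP: "P (P x) = adj_op T (T x)" for x
  proof -
    have "2 *\<^sub>R Y x = B x + Y (Y x)" by (subst Y) simp
    hence "x - Y x - (Y x - Y (Y x)) = A x" by (simp add: B_apply scaleR_2 algebra_simps)
    hence "P (P x) = c\<^sup>2 *\<^sub>R A x"
      by (simp add: P_apply blinfun.bilinear_simps power2_eq_square scaleR_diff_right[symmetric]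
          del: scaleR_diff_right)
    thus ?thesis using c by (simp add: A_apply)
  qed
  have comm: "S (P x) = P (S x)"
    if "\<And>x. S (adj_op T (T x)) = adj_op T (T (S x))" for S :: "'a \<Rightarrow>\<^sub>L 'a" and x
  proof -
    have "S (B x) = B (S x)" for x
      by (simp add: B_apply A_apply blinfun.bilinear_simps that)
    from commutes_with_sqrt_limit[OF lim this] show ?thesis
      by (simp add: P_apply blinfun.bilinear_simps)
  qed
  have "P \<in> bounded_ops"
  proof -
    have "P (a *\<^sub>C x) = a *\<^sub>C P x" for a x
      using comm[of "Blinfun (\<lambda>x. a *\<^sub>C x)" x] bounded_opsD[OF T]
        bounded_opsD[OF adj_op_bounded_ops[OF T]]
      by (simp add: bounded_linear_Blinfun_apply[OF bounded_linear_scaleC])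
    thus ?thesis by (simp add: bounded_ops_def)
  qed
  moreover have "inner (P x) y = inner x (P y)" for x y
  proof -
    have "inner (B x) y = inner x (B y)" for x y by (simp add: B_apply inner_simps A_sa)
    from selfadjoint_sqrt_limit[OF lim this] show ?thesis by (simp add: P_apply inner_simps)
  qed
  moreover have "inner (P x) x \<ge> 0" for x
  proof -
    have "inner (Y x) x \<le> norm (Y x) * norm x" by (rule norm_cauchy_schwarz)
    also have "\<dots> \<le> (1 * norm x) * norm x"
      by (intro mult_right_mono order_trans[OF norm_blinfun] Y1) auto
    finally show ?thesis
      using c by (simp add: P_apply inner_simps power2_norm_eq_inner[symmetric] power2_eq_square[symmetric])
  qed
  ultimately have "positive_op P" by (simp add: positive_op_iff)
  thus thesis using PP comm by (rule that)
qed

lemma abs_op_properties: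
  fixes T S :: "'a::chilbert_space \<Rightarrow>\<^sub>L 'a"
  assumes T: "T \<in> bounded_ops"
  shows positive_abs_op: "positive_op (abs_op T)"
    and abs_op_square: "abs_op T (abs_op T x) = adj_op T (T x)"
    and commutes_with_abs_op: "(\<And>x. S (adj_op T (T x)) = adj_op T (T (S x))) \<Longrightarrow>
      S (abs_op T x) = abs_op T (S x)"
proof -
  obtain P where P: "positive_op P" "\<And>x. P (P x) = adj_op T (T x)"
    and comm: "\<And>(S :: 'a \<Rightarrow>\<^sub>L 'a) x. (\<And>x. S (adj_op T (T x)) = adj_op T (T (S x))) \<Longrightarrow>
      S (P x) = P (S x)"
    using positive_sqrt_exists[OF T] by blast
  have "Q = P" if Q: "positive_op Q \<and> Q o\<^sub>L Q = adj_op T o\<^sub>L T" for Q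
  proof -
    have QQ: "adj_op T (T x) = Q (Q x)" for x
      using Q by (metis blinfun_apply_blinfun_compose)
    show ?thesis
    proof (rule positive_sqrt_unique)
      show "Q (P x) = P (Q x)" for x by (rule comm) (simp add: QQ)
    qed (use Q P QQ in auto)
  qed
  hence "abs_op T = P"
    unfolding abs_op_def sqrt_op_def using P by (intro the_equality) (auto intro: blinfun_eqI)
  thus "positive_op (abs_op T)" "abs_op T (abs_op T x) = adj_op T (T x)"
    "(\<And>x. S (adj_op T (T x)) = adj_op T (T (S x))) \<Longrightarrow>
      S (abs_op T x) = abs_op T (S x)"
    using P comm by auto
qed


section \<open>Polar decomposition\<close>

lemma norm_abs_op:
  fixes T :: "'a::chilbert_space \<Rightarrow>\<^sub>L 'a"
  assumes T: "T \<in> bounded_ops"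
  shows "norm (abs_op T x) = norm (T x)"
proof -
  have "inner (abs_op T x) (abs_op T x) = inner x (abs_op T (abs_op T x))"
    using positive_abs_op[OF T] by (simp add: positive_op_iff)
  also have "\<dots> = inner (T x) (T x)" by (simp add: abs_op_square[OF T] inner_adj_op[OF T])
  finally show ?thesis by (simp add: norm_eq)
qed

lemma subspace_closure:
  fixes S :: "'a::real_normed_vector set"
  assumes S: "subspace S"
  shows "subspace (closure S)"
proof -
  have 0: "0 \<in> closure S" using S closure_subset subspace_0 by blast
  have add: "x + y \<in> closure S" if xy: "x \<in> closure S" "y \<in> closure S" for x y
  proof -
    obtain f g where "\<And>n. f n \<in> S" "f \<longlonglongrightarrow> x" "\<And>n. g n \<in> S" "g \<longlonglongrightarrow> y"
      using xy unfolding closure_sequential by blast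
    thus ?thesis unfolding closure_sequential
      by (intro exI[of _ "\<lambda>n. f n + g n"]) (auto intro: tendsto_intros subspace_add[OF S])
  qed
  have "c *\<^sub>R x \<in> closure S" if x: "x \<in> closure S" for c x
  proof -
    obtain f where "\<And>n. f n \<in> S" "f \<longlonglongrightarrow> x"
      using x unfolding closure_sequential by blast
    thus ?thesis unfolding closure_sequential
      by (intro exI[of _ "\<lambda>n. c *\<^sub>R f n"]) (auto intro: tendsto_intros subspace_scale[OF S])
  qed
  with 0 add show ?thesis by (simp add: subspace_def)
qed

lemma subspace_range_blinfun: "subspace (range (blinfun_apply P))"
  by (intro subspace_UNIV linear_subspace_image bounded_linear.linear blinfun.bounded_linear_right)

lemma kernel_orthogonal_closure_range:
  fixes P :: "'a::real_inner \<Rightarrow>\<^sub>L 'a"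
  assumes sa: "\<And>x y. inner (P x) y = inner x (P y)"
    and k: "P k = 0" and u: "u \<in> closure (range P)"
  shows "inner k u = 0"
proof -
  have "range P \<subseteq> {u. inner k u = 0}" by (auto simp: sa[symmetric] k)
  moreover have "closed {u. inner k u = 0}"
    by (intro closed_Collect_eq continuous_intros)
  ultimately show ?thesis using u closure_minimal by blast
qed

text \<open>
  A vector orthogonal to the range of a self-adjoint \<open>P\<close> is in its kernel, so projecting onto the
  closed range leaves a remainder in the kernel.
\<close>
lemma closure_range_kernel_decomposition:
  fixes P :: "'a::{real_inner, complete_space} \<Rightarrow>\<^sub>L 'a"
  assumes sa: "\<And>x y. inner (P x) y = inner x (P y)"
  obtains u k where "x = u + k" and "u \<in> closure (range P)" and "P k = 0" and "inner k u = 0"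
proof -
  obtain u where u: "u \<in> closure (range P)"
    and orth: "\<And>y. y \<in> closure (range P) \<Longrightarrow> inner (x - u) y = 0"
    by (rule closed_subspace_orthogonal_decomposition
          [OF subspace_closure[OF subspace_range_blinfun[of P]] closed_closure, where x = x]) blast
  have "inner (P (x - u)) (P (x - u)) = inner (x - u) (P (P (x - u)))" by (rule sa)
  also have "\<dots> = 0" by (intro orth subsetD[OF closure_subset] rangeI)
  finally have "P (x - u) = 0" by simp
  thus thesis using that[of u "x - u"] u orth[OF u] by simp
qed

lemma blinfun_eqI_range_kernel:
  fixes P A B :: "'a::{real_inner, complete_space} \<Rightarrow>\<^sub>L 'a"
  assumes sa: "\<And>x y. inner (P x) y = inner x (P y)"
    and range: "\<And>x. A (P x) = B (P x)" and kernel: "\<And>k. P k = 0 \<Longrightarrow> A k = B k"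
  shows "A = B"
proof (rule blinfun_eqI)
  fix x
  obtain u k where x: "x = u + k" and u: "u \<in> closure (range P)" and k: "P k = 0"
    using closure_range_kernel_decomposition[OF sa] by metis
  have "closed {u. A u = B u}"
    by (intro closed_Collect_eq linear_continuous_on blinfun.bounded_linear_right)
  moreover have "range P \<subseteq> {u. A u = B u}" using range by auto
  ultimately have "A u = B u" using u closure_minimal by blast
  thus "A x = B x" by (simp add: x blinfun.bilinear_simps kernel[OF k])
qed

text \<open>
  The closure \<open>G\<close> of the set of pairs \<open>(P x, T x)\<close> is the graph of an isometry whose domain is the
  closed range of \<open>P\<close>: norms agree on \<open>G\<close> by continuity, and completeness lets any limit of vectors
  \<open>P x\<close> be followed by the corresponding \<open>T x\<close>. Adding the kernel of \<open>P\<close> to the domain, with value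
  zero, gives an operator defined everywhere, since the kernel is the orthogonal complement of the
  closed range.
\<close>
lemma polar_factor_exists:
  fixes P T :: "'a::{real_inner, banach} \<Rightarrow>\<^sub>L 'a"
  assumes sa: "\<And>x y. inner (P x) y = inner x (P y)" and norm_eq: "\<And>x. norm (P x) = norm (T x)"
  obtains V :: "'a \<Rightarrow>\<^sub>L 'a" where "\<And>x. V (P x) = T x" and "\<And>k. P k = 0 \<Longrightarrow> V k = 0"
    and "\<And>u. u \<in> closure (range P) \<Longrightarrow> norm (V u) = norm u"
proof -
  define G where "G = closure (range (\<lambda>x. (P x, T x)))"
  have "subspace (range (\<lambda>x. (P x, T x)))"
    by (intro subspace_UNIV linear_subspace_image bounded_linear.linear bounded_linear_Pair
        blinfun.bounded_linear_right)
  hence G: "subspace G" unfolding G_def by (rule subspace_closure)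
  have G_norm: "norm v = norm u" if "(u, v) \<in> G" for u v
  proof -
    have "closed {z::'a \<times> 'a. norm (snd z) = norm (fst z)}"
      by (intro closed_Collect_eq continuous_intros)
    moreover have "range (\<lambda>x. (P x, T x)) \<subseteq> {z. norm (snd z) = norm (fst z)}"
      using norm_eq by auto
    ultimately have "G \<subseteq> {z. norm (snd z) = norm (fst z)}"
      unfolding G_def by (rule closure_minimal[rotated])
    thus ?thesis using that by auto
  qed
  have G_dom: "u \<in> closure (range P)" if "(u, v) \<in> G" for u v
  proof -
    have "G \<subseteq> closure (range P \<times> UNIV)" unfolding G_def by (intro closure_mono) auto
    thus ?thesis using that by (auto simp: closure_Times)
  qed
  have G_ex: "\<exists>v. (u, v) \<in> G" if u: "u \<in> closure (range P)" for u
  proof -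
    obtain f where "\<And>n. f n \<in> range P" and lim: "f \<longlonglongrightarrow> u"
      using u unfolding closure_sequential by blast
    hence "\<exists>x. f n = P x" for n by (meson rangeE)
    then obtain x where x: "\<And>n. f n = P (x n)" by metis
    have "dist (T (x m)) (T (x n)) = dist (f m) (f n)" for m n
      using norm_eq[of "x m - x n"] by (simp add: dist_norm x blinfun.bilinear_simps)
    moreover have "Cauchy f" using lim by (rule LIMSEQ_imp_Cauchy)
    ultimately have "Cauchy (\<lambda>n. T (x n))" by (simp add: Cauchy_def)
    then obtain v where "(\<lambda>n. T (x n)) \<longlonglongrightarrow> v" using Cauchy_convergent convergent_def by blast
    hence "(\<lambda>n. (P (x n), T (x n))) \<longlonglongrightarrow> (u, v)"
      using lim by (intro tendsto_Pair) (simp_all add: x[symmetric])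
    moreover have "(P (x n), T (x n)) \<in> range (\<lambda>x. (P x, T x))" for n by simp
    ultimately have "(u, v) \<in> G" unfolding G_def closure_sequential
      by (intro exI[of _ "\<lambda>n. (P (x n), T (x n))"] conjI allI)
    thus ?thesis ..
  qed
  define R where "R x v \<longleftrightarrow> (\<exists>k. P k = 0 \<and> (x - k, v) \<in> G)" for x v
  have R_unique: "v = v'" if R: "R x v" "R x v'" for x v v'
  proof -
    obtain k k' where k: "P k = 0" "(x - k, v) \<in> G" "P k' = 0" "(x - k', v') \<in> G"
      using R unfolding R_def by blast
    hence d: "(k' - k, v - v') \<in> G" using subspace_diff[OF G k(2,4)] by simp
    have "inner (k' - k) (k' - k) = 0"
      by (rule kernel_orthogonal_closure_range[OF sa _ G_dom[OF d]])
         (simp add: blinfun.bilinear_simps k)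
    thus ?thesis using G_norm[OF d] by simp
  qed
  have "\<exists>v. R x v" for x
  proof -
    obtain u k where "x = u + k" "u \<in> closure (range P)" "P k = 0"
      using closure_range_kernel_decomposition[OF sa] by metis
    moreover then obtain v where "(u, v) \<in> G" using G_ex[of u] by blast
    ultimately have "R x v" by (auto simp: R_def intro!: exI[of _ k])
    thus ?thesis ..
  qed
  then obtain V where V: "\<And>x. R x (V x)" by metis
  have V_eq: "V x = v" if "R x v" for x v using R_unique[OF V that] .
  have "bounded_linear V"
  proof (rule bounded_linear_intro[where K = 1])
    show "V (x + y) = V x + V y" for x y
    proof (rule V_eq)
      obtain k l where "P k = 0" "(x - k, V x) \<in> G" "P l = 0" "(y - l, V y) \<in> G"
        using V[of x] V[of y] unfolding R_def by blast
      thus "R (x + y) (V x + V y)"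
        using subspace_add[OF G, of "(x - k, V x)" "(y - l, V y)"]
        by (auto simp: R_def blinfun.bilinear_simps algebra_simps intro!: exI[of _ "k + l"])
    qed
    show "V (r *\<^sub>R x) = r *\<^sub>R V x" for r x
    proof (rule V_eq)
      obtain k where "P k = 0" "(x - k, V x) \<in> G" using V[of x] unfolding R_def by blast
      thus "R (r *\<^sub>R x) (r *\<^sub>R V x)"
        using subspace_scale[OF G, of "(x - k, V x)" r]
        by (auto simp: R_def blinfun.bilinear_simps algebra_simps intro!: exI[of _ "r *\<^sub>R k"])
    qed
    show "norm (V x) \<le> norm x * 1" for x
    proof -
      obtain k where k: "P k = 0" "(x - k, V x) \<in> G" using V[of x] unfolding R_def by blast
      have "inner k (x - k) = 0" by (rule kernel_orthogonal_closure_range[OF sa k(1) G_dom[OF k(2)]])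
      hence "(norm x)\<^sup>2 = (norm (x - k))\<^sup>2 + (norm k)\<^sup>2"
        by (simp add: power2_norm_eq_inner inner_simps inner_commute)
      hence "(norm (x - k))\<^sup>2 \<le> (norm x)\<^sup>2" by simp
      hence "norm (x - k) \<le> norm x" by (rule power2_le_imp_le) simp
      thus ?thesis using G_norm[OF k(2)] by simp
    qed
  qed
  hence Bl: "blinfun_apply (Blinfun V) = V" by (rule bounded_linear_Blinfun_apply)
  have "V (P x) = T x" for x
  proof (rule V_eq)
    have "(P x, T x) \<in> G" unfolding G_def by (intro subsetD[OF closure_subset] rangeI)
    thus "R (P x) (T x)" by (auto simp: R_def blinfun.bilinear_simps intro!: exI[of _ 0])
  qed
  moreover have "V k = 0" if "P k = 0" for k
    using that subspace_0[OF G] by (intro V_eq) (auto simp: R_def zero_prod_def intro!: exI[of _ k])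
  moreover have "norm (V u) = norm u" if u: "u \<in> closure (range P)" for u
  proof -
    obtain v where v: "(u, v) \<in> G" using G_ex[OF u] by blast
    hence "V u = v" by (intro V_eq) (auto simp: R_def blinfun.bilinear_simps intro!: exI[of _ 0])
    thus ?thesis using G_norm[OF v] by simp
  qed
  ultimately show thesis using that[of "Blinfun V"] by (simp add: Bl)
qed

text \<open>
  The orthogonal complement of the kernel of the polar factor is the closed range of \<open>|T|\<close>, so
  isometry there is what makes it a partial isometry. Uniqueness and complex linearity both come from
  \<open>blinfun_eqI_range_kernel\<close>: the values on the range of \<open>|T|\<close> and on the kernel are prescribed.
\<close>
lemma polar_op_properties:
  fixes T :: "'a::chilbert_space \<Rightarrow>\<^sub>L 'a"
  assumes T: "T \<in> bounded_ops"
  shows polar_op_abs_op: "polar_op T (abs_op T x) = T x"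
    and polar_op_kernel: "T k = 0 \<Longrightarrow> polar_op T k = 0"
    and polar_op_isometric: "u \<in> closure (range (abs_op T)) \<Longrightarrow> norm (polar_op T u) = norm u"
proof -
  define P where "P = abs_op T"
  have P: "P \<in> bounded_ops" and sa: "\<And>x y. inner (P x) y = inner x (P y)"
    using positive_abs_op[OF T] by (simp_all add: positive_op_iff P_def)
  have norm_eq: "norm (P x) = norm (T x)" for x unfolding P_def by (rule norm_abs_op[OF T])
  have ker: "P x = 0 \<longleftrightarrow> T x = 0" for x using norm_eq[of x] by (metis norm_eq_zero)
  obtain V :: "'a \<Rightarrow>\<^sub>L 'a" where VP: "\<And>x. V (P x) = T x" and Vk: "\<And>k. P k = 0 \<Longrightarrow> V k = 0"
    and Vn: "\<And>u. u \<in> closure (range P) \<Longrightarrow> norm (V u) = norm u"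
    using polar_factor_exists[OF sa norm_eq] by blast
  have "V \<in> bounded_ops"
  proof -
    have "V (a *\<^sub>C x) = a *\<^sub>C V x" for a x
    proof -
      let ?m = "Blinfun (\<lambda>x. a *\<^sub>C x)"
      have m: "?m x = a *\<^sub>C x" for x :: 'a
        by (simp add: bounded_linear_Blinfun_apply[OF bounded_linear_scaleC])
      have "V o\<^sub>L ?m = ?m o\<^sub>L V"
      proof (rule blinfun_eqI_range_kernel[OF sa])
        show "(V o\<^sub>L ?m) (P x) = (?m o\<^sub>L V) (P x)" for x
          by (simp add: m VP bounded_opsD[OF P, symmetric] bounded_opsD[OF T])
        show "(V o\<^sub>L ?m) k = (?m o\<^sub>L V) k" if "P k = 0" for k
          using that Vk[of "a *\<^sub>C k"] Vk[of k] m[of 0] by (simp add: m bounded_opsD[OF P] blinfun.zero_right)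
      qed
      thus ?thesis by (metis blinfun_apply_blinfun_compose m)
    qed
    thus ?thesis by (simp add: bounded_ops_def)
  qed
  moreover have "ker_op V = ker_op T"
  proof -
    have "P x = 0" if "V x = 0" for x
    proof -
      obtain u k where x: "x = u + k" and u: "u \<in> closure (range P)" and k: "P k = 0"
        using closure_range_kernel_decomposition[OF sa] by metis
      have "V u = 0" using that by (simp add: x blinfun.bilinear_simps Vk[OF k])
      hence "u = 0" using Vn[OF u] by simp
      thus ?thesis by (simp add: x k)
    qed
    thus ?thesis using Vk ker by (auto simp: ker_op_def)
  qed
  moreover have "norm (V x) = norm x" if x: "x \<in> corthogonal_comp (ker_op V)" for x
  proof -
    obtain u k where uk: "x = u + k" and u: "u \<in> closure (range P)" and k: "P k = 0" "inner k u = 0"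
      using closure_range_kernel_decomposition[OF sa] by metis
    have "cinner x k = 0" using x Vk[OF k(1)] by (simp add: corthogonal_comp_def ker_op_def)
    hence "inner x k = 0" by (simp add: inner_eq_Re_cinner)
    hence "inner k k = 0" using k(2) by (simp add: uk inner_simps inner_commute)
    thus ?thesis using Vn[OF u] by (simp add: uk)
  qed
  ultimately have "partial_isometry V \<and> T = V o\<^sub>L abs_op T \<and> ker_op V = ker_op T"
    by (auto simp: partial_isometry_def VP P_def[symmetric] intro: blinfun_eqI)
  moreover have "W = V"
    if W: "partial_isometry W \<and> T = W o\<^sub>L abs_op T \<and> ker_op W = ker_op T" for W
  proof (rule blinfun_eqI_range_kernel[OF sa])
    show "W (P x) = V (P x)" for x
      using W by (metis P_def VP blinfun_apply_blinfun_compose)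
    show "W k = V k" if "P k = 0" for k
      using W that Vk[OF that] ker by (auto simp: ker_op_def)
  qed
  ultimately have "polar_op T = V" unfolding polar_op_def by (rule the_equality)
  thus "polar_op T (abs_op T x) = T x" "T k = 0 \<Longrightarrow> polar_op T k = 0"
    "u \<in> closure (range (abs_op T)) \<Longrightarrow> norm (polar_op T u) = norm u"
    using VP Vk Vn ker by (simp_all add: P_def)
qed

text \<open>
  This is \<open>V\<^sup>* T = |T|\<close> as a quadratic form. Only the component of \<open>y\<close> in the closed range of \<open>|T|\<close>
  matters on either side, and there \<open>V\<close> preserves norms, hence inner products.
\<close>
lemma inner_polar_op:
  fixes T :: "'a::chilbert_space \<Rightarrow>\<^sub>L 'a"
  assumes T: "T \<in> bounded_ops"
  shows "inner (T y) (polar_op T y) = inner (abs_op T y) y"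
proof -
  define P V where "P = abs_op T" and "V = polar_op T"
  have sa: "\<And>x y. inner (P x) y = inner x (P y)"
    using positive_abs_op[OF T] by (simp add: positive_op_iff P_def)
  have iso: "norm (V u) = norm u" if "u \<in> closure (range P)" for u
    using polar_op_isometric[OF T] that by (simp add: P_def V_def)
  obtain u k where y: "y = u + k" and u: "u \<in> closure (range P)" and k: "P k = 0"
    using closure_range_kernel_decomposition[OF sa] by metis
  have "T k = 0" using norm_abs_op[OF T, of k] k by (simp add: P_def)
  hence Vk: "V k = 0" unfolding V_def by (rule polar_op_kernel[OF T])
  have Py: "P y \<in> closure (range P)" by (rule subsetD[OF closure_subset rangeI])
  have sum: "P y + u \<in> closure (range P)"
    by (rule subspace_add[OF subspace_closure[OF subspace_range_blinfun] Py u])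
  have "V y = V u" by (simp add: y Vk blinfun.bilinear_simps)
  moreover have "V (P y) = T y" unfolding V_def P_def by (rule polar_op_abs_op[OF T])
  ultimately have "inner (T y) (V y) = inner (V (P y)) (V u)" by simp
  also have "\<dots> = inner (P y) u"
    using iso[OF Py] iso[OF u] iso[OF sum]
    by (simp add: dot_norm blinfun.bilinear_simps)
  also have "\<dots> = inner (P y) y" by (simp add: y inner_add_right sa[of _ k] k)
  finally show ?thesis by (simp add: P_def V_def)
qed

section \<open>Square-zero mean transforms\<close>

theorem theorem5p1:
  fixes T :: "'a::chilbert_space \<Rightarrow>\<^sub>L 'a"
  assumes "T \<in> bounded_ops"
  shows "mean_transform T o\<^sub>L mean_transform T = 0 \<longleftrightarrow> T o\<^sub>L T = 0"
proof -
  define P V where "P = abs_op T" and "V = polar_op T"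
  define N where "N = T + (P o\<^sub>L V)"
  note T = assms
  have P: "positive_op P" unfolding P_def by (rule positive_abs_op[OF T])
  hence sa: "\<And>x y. inner (P x) y = inner x (P y)" and pos: "\<And>x. inner (P x) x \<ge> 0"
    unfolding positive_op_iff by blast+
  have VP: "V (P x) = T x" for x unfolding P_def V_def by (rule polar_op_abs_op[OF T])
  have ker: "P x = 0 \<longleftrightarrow> T x = 0" for x
    unfolding P_def using norm_abs_op[OF T, of x] by (metis norm_eq_zero)
  have Vk: "V k = 0" if "P k = 0" for k
    using that polar_op_kernel[OF T] by (simp add: ker V_def)
  have N_apply: "N x = T x + P (V x)" for x by (simp add: N_def blinfun.bilinear_simps)
  have "mean_transform T = (1/2) *\<^sub>R N" by (simp add: mean_transform_def N_def P_def V_def)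
  hence "mean_transform T o\<^sub>L mean_transform T = (1/4) *\<^sub>R (N o\<^sub>L N)"
    by (intro blinfun_eqI) (simp add: blinfun.bilinear_simps)
  hence "mean_transform T o\<^sub>L mean_transform T = 0 \<longleftrightarrow> N o\<^sub>L N = 0" by simp
  also have "\<dots> \<longleftrightarrow> T o\<^sub>L T = 0"
  proof
    assume "N o\<^sub>L N = 0"
    hence NN: "N (N x) = 0" for x by (metis blinfun_apply_blinfun_compose blinfun.zero_left)
    have PN: "P (N x) = 0" for x
    proof -
      define y where "y = N x"
      have "0 = inner (T y + P (V y)) (V y)" using NN[of x] by (simp add: y_def N_apply[symmetric])
      also have "\<dots> = inner (P y) y + inner (P (V y)) (V y)"
        using inner_polar_op[OF T, of y] by (simp add: inner_add_left P_def V_def)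
      finally have "inner (P y) y = 0" using pos[of y] pos[of "V y"] by linarith
      thus ?thesis using positive_op_form_zero[OF P] by (simp add: y_def)
    qed
    \<comment> \<open>\<open>P V\<close> anticommutes with \<open>P\<close>, hence commutes with \<open>P\<^sup>2\<close> and with its square root \<open>P\<close>.\<close>
    have anti: "P (V (P x)) = - P (P (V x))" for x
      using PN[of x] by (simp add: N_apply VP blinfun.bilinear_simps eq_neg_iff_add_eq_0)
    have "(P o\<^sub>L V) (P x) = P ((P o\<^sub>L V) x)" for x
      unfolding P_def
    proof (rule commutes_with_abs_op[OF T])
      fix x
      show "(abs_op T o\<^sub>L V) (adj_op T (T x)) = adj_op T (T ((abs_op T o\<^sub>L V) x))"
        using anti by (simp add: abs_op_square[OF T, symmetric] P_def[symmetric] blinfun.bilinear_simps)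
    qed
    hence PPV: "P (P (V x)) = 0" for x
      using anti[of x] by (simp add: eq_neg_iff_add_eq_0 flip: scaleR_2)
    have "P (V x) = 0" for x
    proof -
      have "inner (P (V x)) (P (V x)) = 0" using PPV[of x] by (simp add: sa)
      thus ?thesis by simp
    qed
    hence "T (T x) = 0" for x by (metis VP ker)
    thus "T o\<^sub>L T = 0" by (intro blinfun_eqI) simp
  next
    assume "T o\<^sub>L T = 0"
    hence TT: "T (T x) = 0" for x by (metis blinfun_apply_blinfun_compose blinfun.zero_left)
    have "P o\<^sub>L V = 0"
    proof (rule blinfun_eqI_range_kernel[OF sa])
      show "(P o\<^sub>L V) (P x) = blinfun_apply 0 (P x)" for x using TT[of x] by (simp add: VP ker)
      show "(P o\<^sub>L V) k = blinfun_apply 0 k" if "P k = 0" for k using Vk[OF that] by (simp add: blinfun.zero_right)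
    qed
    thus "N o\<^sub>L N = 0" using \<open>T o\<^sub>L T = 0\<close> by (simp add: N_def)
  qed
  finally show ?thesis .
qed

end
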